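(* Let $r,\rho,h,w,I_{\rm s},J>0$ and $c=\frac{\rho I_{\rm s}}{2w(I_{\rm s}+J)}$. Let $D\subset\mathbb{R}^2$ be a compact domain in the $(\varphi_1,\varphi_2)$-plane bounded by a piecewise smooth simple closed curve, and let $\Gamma\colon[0,T]\to\mathbb{R}^2$, $\Gamma(t)=(\varphi_1(t),\varphi_2(t))$, be a piecewise smooth loop traversing $\partial D$ once in the positive (counterclockwise) direction. Let $\mathbf{x}\colon[0,T]\to\mathbb{R}^2$ be a solution of $$\dot{\mathbf{x}}=\frac{r\rho}{2h}(\dot\varphi_1+\dot\varphi_2)\begin{bmatrix}-\sin(c(\varphi_1-\varphi_2))\\ \cos(c(\varphi_1-\varphi_2))\end{bmatrix}.$$ Then $$\mathbf{x}(T)-\mathbf{x}(0)=-\frac{c\,r\rho}{h}\int_D\begin{bmatrix}\cos(c(\varphi_1-\varphi_2))\\ \sin(c(\varphi_1-\varphi_2))\end{bmatrix}d\varphi_1\,d\varphi_2 .$$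
   Context: Here $\varphi_1,\varphi_2$ are the angles of the two internal wheels of a spherical rolling robot, taken in the covering space $\mathbb{R}^2$ of the shape space $\mathbb{S}^1\times\mathbb{S}^1$, and $\mathbf{x}$ is the horizontal position of the center of the sphere; the differential equation is the translational part of the robot's rolling constraints. The displacement $\mathbf{x}(T)-\mathbf{x}(0)$ is called the translational holonomy (geometric phase) of the loop. *)

theory Defs
  imports "HOL-Complex_Analysis.Complex_Analysis"
begin

(* Piecewise C^1 with one-sided derivatives at the break points: g is C^1 on each closed piece.
   The library's piecewise_C1_differentiable_on allows the derivative to be unbounded near a
   break point.  Continuity of g on {a..b} follows, because the pieces are closed and overlap
   at the break points. *)
definition piecewise_smooth_on :: "(real \<Rightarrow> 'a::real_normed_vector) \<Rightarrow> real \<Rightarrow> real \<Rightarrow> bool" where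
  "piecewise_smooth_on g a b \<longleftrightarrow>
     (\<exists>p. p division_of {a..b} \<and>
          (\<forall>K\<in>p. \<exists>g'. continuous_on K g' \<and>
                      (\<forall>t\<in>K. (g has_vector_derivative g' t) (at t within K))))"

(* The closure condition excludes sets such as the boundary curve itself, which is compact
   and equal to its own frontier. *)
definition compact_domain :: "'a::topological_space set \<Rightarrow> bool" where
  "compact_domain D \<longleftrightarrow>
     compact D \<and> D \<noteq> {} \<and> connected (interior D) \<and> closure (interior D) = D"

(* winding_number expects a path on {0..1} in the complex plane. *)
definition loop_winding_number :: "real \<Rightarrow> (real \<Rightarrow> real \<times> real) \<Rightarrow> real \<times> real \<Rightarrow> complex" where
  "loop_winding_number T \<Gamma> p =
     winding_number (\<lambda>s. Complex (fst (\<Gamma> (T * s))) (snd (\<Gamma> (T * s)))) (Complex (fst p) (snd p))"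

(* The orientation is counterclockwise iff the winding number about interior points is 1
   (for a clockwise simple loop it is -1). *)
definition traverses_frontier_once_positively ::
    "real \<Rightarrow> (real \<Rightarrow> real \<times> real) \<Rightarrow> (real \<times> real) set \<Rightarrow> bool" where
  "traverses_frontier_once_positively T \<Gamma> D \<longleftrightarrow>
     \<Gamma> 0 = \<Gamma> T \<and> inj_on \<Gamma> {0..<T} \<and> \<Gamma> ` {0..T} = frontier D \<and>
     (\<forall>p\<in>interior D. loop_winding_number T \<Gamma> p = 1)"

(* The velocities jump at the break points of the loop, so a solution is a continuous function
   that satisfies the equation at all but finitely many times. *)
definition rolling_solution ::
    "real \<Rightarrow> real \<Rightarrow> real \<Rightarrow> real \<Rightarrow> real \<Rightarrow> (real \<Rightarrow> real) \<Rightarrow> (real \<Rightarrow> real) \<Rightarrow> (real \<Rightarrow> real^2) \<Rightarrow> bool" where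
  "rolling_solution r \<rho> h c T \<phi>\<^sub>1 \<phi>\<^sub>2 x \<longleftrightarrow>
     continuous_on {0..T} x \<and>
     (\<exists>S. finite S \<and>
        (\<forall>t\<in>{0<..<T} - S.
           (x has_vector_derivative
              (r * \<rho> / (2 * h) * (deriv \<phi>\<^sub>1 t + deriv \<phi>\<^sub>2 t)) *\<^sub>R
                vector [- sin (c * (\<phi>\<^sub>1 t - \<phi>\<^sub>2 t)), cos (c * (\<phi>\<^sub>1 t - \<phi>\<^sub>2 t))]) (at t)))"

end

(* Green's theorem for a C^1 function f and a piecewise C^1 loop is obtained without
   decomposing the domain.  Write K(q) = q / |q|^2.
   - After a cutoff, f has compact support and 2 pi f(z) is the integral of grad f(z - q) . K(q)
     over q.  This is the slope substitution y = x s: along every line through z the integrand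
     becomes an x-derivative divided by 1 + s^2, and 1 / (1 + s^2) has integral pi.
   - Hence 2 pi times the line integral of f e . d\<gamma> is the double integral of
     (grad f . K)(e . \<gamma>').  Lagrange's identity
       (grad f x e)(K x \<gamma>') = (grad f . K)(e . \<gamma>') - (grad f . \<gamma>')(e . K)
     replaces it by the integral of (grad f x e)(K x \<gamma>'), since the last term vanishes for every
     q: it integrates the derivative of f(\<gamma> - q) over a closed loop.
   - K(\<gamma> - p) x \<gamma>' integrates along the loop to 2 pi times the winding number about p, which is 1
     inside D and, by the Jordan curve theorem, 0 outside.
   The singularity of K is integrable, so Fubini applies throughout. *)
theory Submission
  imports Defs "HOL-Probability.Sinc_Integral"
begin

section \<open>Integrability of the singularity of the planar kernel\<close>

section \<open>The kernel $q / |q|^2$ in the plane\<close>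

text \<open>In the plane this is the gradient of log |q|, that is, 2 pi times the gradient of the
  fundamental solution of the Laplacian. Its value at 0 is 0, because
  \<open>inverse 0 = 0\<close>.\<close>

definition point_kernel :: "'a::real_normed_vector \<Rightarrow> 'a" where
  "point_kernel q = q /\<^sub>R (norm q)\<^sup>2"

text \<open>The determinant with columns p and q. If G is the gradient of f and e is constant,
  \<open>cross2 (G p) e\<close> is the scalar curl of the field f e, the area integrand in Green's
  theorem.\<close>

definition cross2 :: "real \<times> real \<Rightarrow> real \<times> real \<Rightarrow> real" where
  "cross2 p q = fst p * snd q - snd p * fst q"

lemma cross2_Lagrange:
  "cross2 a b * cross2 c d = (a \<bullet> c) * (b \<bullet> d) - (a \<bullet> d) * (b \<bullet> c)"
  by (simp add: cross2_def inner_prod_def algebra_simps)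

lemma norm_Pair_power2: "(norm (a::real, b::real))\<^sup>2 = a\<^sup>2 + b\<^sup>2"
  by (simp add: norm_Pair)

lemma fst_borel_measurable [measurable]: "fst \<in> borel_measurable (borel :: (real \<times> real) measure)"
  and snd_borel_measurable [measurable]: "snd \<in> borel_measurable (borel :: (real \<times> real) measure)"
  by (auto intro!: borel_measurable_continuous_onI continuous_intros)

lemma point_kernel_measurable [measurable]:
  "point_kernel \<in> borel_measurable (borel :: (real \<times> real) measure)"
  unfolding point_kernel_def by measurable

lemma has_bochner_integral_inverse_1_plus_square:
  "has_bochner_integral lborel (\<lambda>x::real. 1 / (1 + x\<^sup>2)) pi"
  using integrable_inverse_1_plus_square LBINT_inverse_1_plus_square
  by (simp add: has_bochner_integral_iff set_integrable_def interval_lebesgue_integral_def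
      set_lebesgue_integral_def einterval_def inverse_eq_divide)

text \<open>The substitution b = a s absorbs a and leaves the integral of 1 / (1 + s^2). Since the
  value does not depend on a, it stays bounded as a tends to 0, where the singularity lies.\<close>

lemma nn_integral_abs_over_sum_squares:
  fixes a :: real
  assumes "a \<noteq> 0"
  shows "(\<integral>\<^sup>+b. ennreal (\<bar>a\<bar> / (a\<^sup>2 + b\<^sup>2)) \<partial>lborel) = ennreal pi"
proof -
  \<comment> \<open>The summand 0 is the offset of the affine substitution in
    \<open>nn_integral_real_affine\<close>.\<close>
  have *: "\<bar>a\<bar> * (\<bar>a\<bar> / (a\<^sup>2 + (0 + a * s)\<^sup>2)) = 1 / (1 + s\<^sup>2)" for s
  proof -
    have "\<bar>a\<bar> * \<bar>a\<bar> = a\<^sup>2"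
      by (simp add: power2_eq_square)
    moreover have "a\<^sup>2 + (0 + a * s)\<^sup>2 = a\<^sup>2 * (1 + s\<^sup>2)"
      by (simp add: algebra_simps)
    ultimately show ?thesis
      using assms by (simp add: divide_simps)
  qed
  have "(\<integral>\<^sup>+b. ennreal (\<bar>a\<bar> / (a\<^sup>2 + b\<^sup>2)) \<partial>lborel)
      = \<bar>a\<bar> * (\<integral>\<^sup>+s. ennreal (\<bar>a\<bar> / (a\<^sup>2 + (0 + a * s)\<^sup>2)) \<partial>lborel)"
    by (rule nn_integral_real_affine) (use assms in auto)
  also have "\<dots> = (\<integral>\<^sup>+s. ennreal (\<bar>a\<bar> * (\<bar>a\<bar> / (a\<^sup>2 + (0 + a * s)\<^sup>2))) \<partial>lborel)"
    by (simp only: ennreal_mult'[OF abs_ge_zero] nn_integral_cmult borel_measurable_ennreal_iff)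
       (subst nn_integral_cmult, auto)
  also have "\<dots> = (\<integral>\<^sup>+s. ennreal (1 / (1 + s\<^sup>2)) \<partial>lborel)"
    by (simp only: *)
  also have "\<dots> = ennreal pi"
    using has_bochner_integral_inverse_1_plus_square
    by (subst nn_integral_eq_integral) (auto simp: has_bochner_integral_iff)
  finally show ?thesis .
qed

text \<open>By Tonelli: for each a other than 0 the integral over b is pi, so the total is pi times
  the length of {-R..R}.\<close>

lemma integrable_strip_kernel:
  "integrable lborel (\<lambda>q::real \<times> real. indicator {-R..R} (fst q) * (fst q / (norm q)\<^sup>2))"
proof (rule integrableI_bounded)
  have [measurable]: "(\<lambda>q::real \<times> real. indicator {-R..R} (fst q) * (fst q / (norm q)\<^sup>2)) \<in> borel_measurable borel"
    by measurable
  have m: "(\<lambda>q::real \<times> real. ennreal (norm (indicator {-R..R} (fst q) * (fst q / (norm q)\<^sup>2)))) \<in> borel_measurable borel"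
    by measurable
  have "(\<integral>\<^sup>+q. ennreal (norm (indicator {-R..R} (fst q) * (fst q / (norm (q::real\<times>real))\<^sup>2))) \<partial>lborel)
     = (\<integral>\<^sup>+a. \<integral>\<^sup>+b. ennreal (norm (indicator {-R..R} a * (a / (a\<^sup>2 + b\<^sup>2)))) \<partial>lborel \<partial>lborel)"
    by (subst lborel_prod[symmetric], subst lborel.nn_integral_fst[symmetric], subst lborel_prod)
       (simp only: measurable_lborel2 m, simp add: norm_Pair_power2)
  also have "\<dots> = (\<integral>\<^sup>+a. indicator {-R..R} a * (\<integral>\<^sup>+b. ennreal (\<bar>a\<bar> / (a\<^sup>2 + b\<^sup>2)) \<partial>lborel) \<partial>lborel)"
    by (intro nn_integral_cong) (auto simp: indicator_def abs_mult)
  also have "\<dots> = (\<integral>\<^sup>+a. ennreal pi * indicator {-R..R} a \<partial>lborel)"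
    by (intro nn_integral_cong_AE, use AE_lborel_singleton[of 0] in eventually_elim)
       (auto simp: nn_integral_abs_over_sum_squares indicator_def)
  also have "\<dots> < \<infinity>"
    by (subst nn_integral_cmult_indicator) (auto simp: ennreal_mult_less_top emeasure_lborel_Icc_eq)
  finally show "(\<integral>\<^sup>+q. ennreal (norm (indicator {-R..R} (fst q) * (fst q / (norm (q::real\<times>real))\<^sup>2))) \<partial>lborel) < \<infinity>" .
qed measurable

lemma integrable_lborel_swap:
  fixes f :: "real \<times> real \<Rightarrow> 'b::{banach, second_countable_topology}"
  shows "integrable lborel (\<lambda>q. f (snd q, fst q)) \<longleftrightarrow> integrable lborel f"
  using lborel_pair.integrable_product_swap_iff[of f]
  by (simp add: lborel_prod split_beta')

text \<open>The norm of q is at most |fst q| + |snd q|, so the kernel is dominated by the strip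
  kernel plus its mirror image under exchange of the coordinates; the disc lies in both
  strips.\<close>

lemma integrable_point_kernel:
  "integrable lborel (\<lambda>q::real \<times> real. indicator (cball 0 R) q * norm (point_kernel q))"
proof (rule Bochner_Integration.integrable_bound)
  let ?g = "\<lambda>q::real \<times> real. indicator {-R..R} (fst q) * (fst q / (norm q)\<^sup>2)"
  have "norm (snd q, fst q) = norm q" for q :: "real \<times> real"
    by (simp add: norm_prod_def add.commute)
  then have "integrable lborel (\<lambda>q. ?g (snd q, fst q))"
    by (subst integrable_lborel_swap) (rule integrable_strip_kernel)
  then show "integrable lborel (\<lambda>q. \<bar>?g q\<bar> + \<bar>?g (snd q, fst q)\<bar>)"
    using integrable_strip_kernel[of R] by (intro Bochner_Integration.integrable_add integrable_abs)
  have [measurable]: "cball (0::real \<times> real) R \<in> sets borel"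
    by simp
  show "(\<lambda>q::real \<times> real. indicator (cball 0 R) q * norm (point_kernel q)) \<in> borel_measurable lborel"
    by measurable
  show "AE q in lborel. norm (indicator (cball 0 R) q * norm (point_kernel q))
     \<le> norm (\<bar>?g q\<bar> + \<bar>?g (snd q, fst q)\<bar>)"
  proof (rule AE_I2)
    fix q :: "real \<times> real"
    have n: "norm (snd q, fst q) = norm q"
      by (simp add: norm_prod_def add.commute)
    have "norm (point_kernel q) \<le> (\<bar>fst q\<bar> + \<bar>snd q\<bar>) / (norm q)\<^sup>2"
      using norm_Pair_le[of "fst q" "snd q"]
      by (simp add: point_kernel_def divide_inverse mult.commute[of _ "inverse _"] mult_left_mono)
    moreover have "\<bar>fst q\<bar> \<le> norm q" "\<bar>snd q\<bar> \<le> norm q"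
      using norm_fst_le[of "fst q" "snd q"] norm_snd_le[of "snd q" "fst q"] by auto
    ultimately show "norm (indicator (cball 0 R) q * norm (point_kernel q))
        \<le> norm (\<bar>?g q\<bar> + \<bar>?g (snd q, fst q)\<bar>)"
      unfolding fst_conv snd_conv n
      by (auto simp: indicator_def abs_mult add_divide_distrib abs_le_iff)
  qed
qed

section \<open>Recovering a compactly supported function from its gradient and the kernel\<close>

section \<open>Representing a function by its gradient\<close>

locale compactly_supported_C1 =
  fixes f :: "real \<times> real \<Rightarrow> real" and G :: "real \<times> real \<Rightarrow> real \<times> real" and M :: real
  assumes f_deriv: "\<And>p. (f has_derivative (\<lambda>v. G p \<bullet> v)) (at p)"
    and G_cont: "continuous_on UNIV G"
    and f_zero: "\<And>p. M \<le> norm p \<Longrightarrow> f p = 0"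
begin

lemma f_cont: "continuous_on UNIV f"
  by (intro continuous_at_imp_continuous_on ballI has_derivative_continuous[OF f_deriv])

lemma f_measurable [measurable]: "f \<in> borel_measurable borel"
  using f_cont by (rule borel_measurable_continuous_onI)

lemma G_measurable [measurable]: "G \<in> borel_measurable borel"
  using G_cont by (rule borel_measurable_continuous_onI)

text \<open>The strict inequality gives p a neighbourhood on which f vanishes, so the derivative at
  p is 0; applying it to the vector \<open>G p\<close> itself yields |G p|^2 = 0.\<close>

lemma G_zero:
  assumes "M < norm p"
  shows "G p = 0"
proof -
  have "open {p::real \<times> real. M < norm p}"
    by (intro open_Collect_less continuous_intros)
  then have "(f has_derivative (\<lambda>v. 0)) (at p)"
    by (rule has_derivative_transform_within_open[OF has_derivative_const[of 0]])
       (use assms f_zero in auto)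
  then have "(\<lambda>v. G p \<bullet> v) = (\<lambda>v. 0)"
    using f_deriv has_derivative_unique by blast
  then have "G p \<bullet> G p = 0"
    by metis
  then show ?thesis
    by simp
qed

lemma G_bounded:
  obtains B where "0 \<le> B" "\<And>p. norm (G p) \<le> B"
proof -
  have "bounded (G ` cball 0 M)"
    by (intro compact_imp_bounded compact_continuous_image continuous_on_subset[OF G_cont]) auto
  then obtain B where B: "\<And>p. p \<in> cball 0 M \<Longrightarrow> norm (G p) \<le> B"
    unfolding bounded_iff by blast
  have "norm (G p) \<le> max B 0" for p
    using B[of p] G_zero[of p] by (cases "norm p \<le> M") auto
  then show ?thesis
    using that[of "max B 0"] by auto
qed

lemma f_bounded:
  obtains B where "0 \<le> B" "\<And>p. norm (f p) \<le> B"
proof -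
  have "bounded (f ` cball 0 M)"
    by (intro compact_imp_bounded compact_continuous_image continuous_on_subset[OF f_cont]) auto
  then obtain B where B: "\<And>p. p \<in> cball 0 M \<Longrightarrow> norm (f p) \<le> B"
    unfolding bounded_iff by blast
  have "norm (f p) \<le> max B 0" for p
    using B[of p] f_zero[of p] by (cases "norm p \<le> M") auto
  then show ?thesis
    using that[of "max B 0"] by auto
qed

text \<open>The gradient is bounded, and it vanishes at z - q once |q| exceeds M + |z|, so a
  multiple of the kernel on a disc dominates the integrand.\<close>

lemma integrable_G_point_kernel:
  "integrable lborel (\<lambda>q. G (z - q) \<bullet> point_kernel q)"
proof -
  obtain B where B: "0 \<le> B" "\<And>p. norm (G p) \<le> B"
    by (rule G_bounded) blast
  show ?thesis
  proof (rule Bochner_Integration.integrable_bound)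
    show "integrable lborel (\<lambda>q. B * (indicator (cball 0 (M + norm z)) q * norm (point_kernel q :: real \<times> real)))"
      by (intro integrable_mult_right integrable_point_kernel)
    show "AE q in lborel. norm (G (z - q) \<bullet> point_kernel q)
        \<le> norm (B * (indicator (cball 0 (M + norm z)) q * norm (point_kernel q)))"
    proof (rule AE_I2)
      fix q
      show "norm (G (z - q) \<bullet> point_kernel q)
        \<le> norm (B * (indicator (cball 0 (M + norm z)) q * norm (point_kernel q)))"
      proof (cases "norm q \<le> M + norm z")
        case True
        have "norm (G (z - q) \<bullet> point_kernel q) \<le> norm (G (z - q)) * norm (point_kernel q)"
          using Cauchy_Schwarz_ineq2 by simp
        also have "\<dots> \<le> B * norm (point_kernel q)"
          by (intro mult_right_mono B) simp
        finally show ?thesis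
          using True B by simp
      next
        case False
        then have "M < norm (z - q)"
          using norm_triangle_ineq2[of q z] by (simp add: norm_minus_commute)
        then show ?thesis
          by (simp add: G_zero)
      qed
    qed
  qed measurable
qed

text \<open>On the line of slope s through z the integrand is, up to sign, the derivative of f. The
  fundamental theorem of calculus on each half-line gives f z, because f vanishes far out; the
  factor \<open>sgn x\<close> makes the two contributions add instead of cancel.\<close>

lemma has_bochner_integral_sgn_line_derivative:
  "has_bochner_integral lborel (\<lambda>x. sgn x * (G (z - (x, x * s)) \<bullet> (1, s))) (2 * f z)"
proof -
  define \<phi> where "\<phi> x = f (z - (x, x * s))" for x
  define \<phi>' where "\<phi>' x = - (G (z - (x, x * s)) \<bullet> (1, s))" for x
  \<comment> \<open>For |x| = R the point z - (x, x s) has norm at least |M|, so f vanishes at both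
    end points.\<close>
  define R where "R = \<bar>M\<bar> + norm z"
  have "0 \<le> R"
    by (simp add: R_def)
  have far: "\<bar>x\<bar> - norm z \<le> norm (z - (x, x * s))" for x
    using norm_triangle_ineq2[of "(x, x * s)" z] norm_fst_le[of x "x * s"]
    by (simp add: norm_minus_commute)
  have d: "(\<phi> has_vector_derivative \<phi>' x) (at x within A)" for x A
  proof -
    have "((\<lambda>x. z - (x, x * s)) has_derivative (\<lambda>v. - (v, v * s))) (at x within A)"
      by (auto intro!: derivative_eq_intros)
    from has_derivative_compose[OF this f_deriv]
    have "(\<phi> has_derivative (\<lambda>v. G (z - (x, x * s)) \<bullet> (- (v, v * s)))) (at x within A)"
      by (simp add: \<phi>_def[abs_def])
    moreover have "G (z - (x, x * s)) \<bullet> (- (v, v * s)) = v *\<^sub>R \<phi>' x" for v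
      by (simp add: \<phi>'_def inner_prod_def algebra_simps)
    ultimately show ?thesis
      by (simp add: has_vector_derivative_def)
  qed
  have c: "continuous_on A \<phi>'" for A
    unfolding \<phi>'_def
    by (intro continuous_intros continuous_on_compose2[OF G_cont]) auto
  have "\<phi> R = 0" "\<phi> (- R) = 0"
    using far[of R] far[of "-R"] \<open>0 \<le> R\<close> by (auto simp: \<phi>_def R_def intro!: f_zero)
  moreover have "\<phi> 0 = f z"
    by (simp add: \<phi>_def zero_prod_def[symmetric])
  ultimately have "has_bochner_integral lborel
      (\<lambda>x. indicator {-R..0} x *\<^sub>R \<phi>' x - indicator {0..R} x *\<^sub>R \<phi>' x) ((f z - 0) - (0 - f z))"
    using has_bochner_integral_FTC_Icc[of "-R" 0 \<phi> \<phi>'] has_bochner_integral_FTC_Icc[of 0 R \<phi> \<phi>'] d c \<open>0 \<le> R\<close>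
    by (intro has_bochner_integral_diff) auto
  then have *: "has_bochner_integral lborel
      (\<lambda>x. indicator {-R..0} x *\<^sub>R \<phi>' x - indicator {0..R} x *\<^sub>R \<phi>' x) (2 * f z)"
    by simp
  have g: "\<phi>' x = 0" if "\<bar>x\<bar> > R" for x
    using far[of x] that by (simp add: \<phi>'_def R_def G_zero)
  have [measurable]: "\<phi>' \<in> borel_measurable borel"
    using c by (rule borel_measurable_continuous_onI)
  have sgn_eq: "(\<lambda>x. sgn x * (G (z - (x, x * s)) \<bullet> (1, s))) = (\<lambda>x. - (sgn x * \<phi>' x))"
    by (simp add: \<phi>'_def)
  show ?thesis
    unfolding sgn_eq
  proof (subst has_bochner_integral_cong_AE)
    show "AE x in lborel. - (sgn x * \<phi>' x) = indicator {-R..0} x *\<^sub>R \<phi>' x - indicator {0..R} x *\<^sub>R \<phi>' x"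
      using AE_lborel_singleton[of 0]
    proof eventually_elim
      case (elim x)
      then show ?case
        using g[of x] by (cases "\<bar>x\<bar> > R") (auto simp: sgn_if indicator_def)
    qed
  qed (use * in auto)
qed

text \<open>In the coordinates (x, s) with y = x s, the integral over x for a fixed slope is 2 f z /
  (1 + s^2), and the integral of 1 / (1 + s^2) over all slopes is pi.\<close>

proposition point_kernel_representation:
  "(\<integral>q. G (z - q) \<bullet> point_kernel q \<partial>lborel) = 2 * pi * f z"
proof -
  define h where "h q = G (z - q) \<bullet> point_kernel q" for q
  \<comment> \<open>The integrand in the coordinates (x, s), including the Jacobian |x|: one power
    of x from the kernel and the Jacobian combine to \<open>sgn x\<close>.\<close>
  define H where "H x s = sgn x * (G (z - (x, x * s)) \<bullet> (1, s)) / (1 + s\<^sup>2)" for x s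
  have subst: "\<bar>x\<bar> * h (x, 0 + x * s) = H x s" if "x \<noteq> 0" for x s
  proof -
    have "x\<^sup>2 + (x * s)\<^sup>2 = x\<^sup>2 * (1 + s\<^sup>2)"
      by (simp add: algebra_simps)
    then have "h (x, 0 + x * s) = (G (z - (x, x * s)) \<bullet> x *\<^sub>R (1, s)) / (x\<^sup>2 * (1 + s\<^sup>2))"
      by (simp add: h_def point_kernel_def norm_Pair_power2 inner_prod_def divide_inverse algebra_simps)
    also have "\<dots> = (G (z - (x, x * s)) \<bullet> (1, s)) / (x * (1 + s\<^sup>2))"
      by (simp only: inner_scaleR_right power2_eq_square mult.assoc mult_divide_mult_cancel_left[OF that])
    finally show ?thesis
      using that by (simp add: H_def sgn_if)
  qed
  have h_int: "integrable (lborel \<Otimes>\<^sub>M lborel) h"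
    unfolding lborel_prod h_def by (rule integrable_G_point_kernel)
  have ne0: "AE x in lborel. x \<noteq> (0::real)"
    by (rule AE_lborel_singleton)
  have H_meas: "case_prod H \<in> borel_measurable (lborel \<Otimes>\<^sub>M lborel)"
  proof -
    have "(\<lambda>p::real \<times> real. G (z - (fst p, fst p * snd p))) \<in> borel_measurable borel"
      by (intro borel_measurable_continuous_onI continuous_on_compose2[OF G_cont] continuous_intros) auto
    then show ?thesis
      unfolding lborel_prod H_def split_beta by measurable
  qed
  \<comment> \<open>The substitution y = x s on each vertical line with nonzero x carries the
    iterated integral of |h| over to |H|, so integrability is inherited from
    \<open>h\<close>.\<close>
  have H_int: "integrable (lborel \<Otimes>\<^sub>M lborel) (case_prod H)"
  proof (rule lborel_pair.Fubini_integrable[OF H_meas])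
    show "integrable lborel (\<lambda>x. \<integral>s. norm (case (x, s) of (x, s) \<Rightarrow> H x s) \<partial>lborel)"
    proof (rule integrable_cong_AE_imp)
      show "integrable lborel (\<lambda>x. \<integral>y. norm (h (x, y)) \<partial>lborel)"
        by (rule lborel_pair.integrable_fst'[OF integrable_norm[OF h_int]])
      show "(\<lambda>x. \<integral>s. norm (case (x, s) of (x, s) \<Rightarrow> H x s) \<partial>lborel) \<in> borel_measurable lborel"
        using H_meas by measurable
      show "AE x in lborel. (\<integral>y. norm (h (x, y)) \<partial>lborel) = (\<integral>s. norm (case (x, s) of (x, s) \<Rightarrow> H x s) \<partial>lborel)"
        using ne0
      proof eventually_elim
        case (elim x)
        then have "(\<integral>y. norm (h (x, y)) \<partial>lborel) = \<bar>x\<bar> *\<^sub>R (\<integral>s. norm (h (x, 0 + x * s)) \<partial>lborel)"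
          by (rule lborel_integral_real_affine)
        also have "\<dots> = (\<integral>s. norm (\<bar>x\<bar> * h (x, 0 + x * s)) \<partial>lborel)"
          by (simp add: abs_mult)
        finally show ?case
          by (simp only: subst[OF elim] prod.case)
      qed
    qed
    show "AE x in lborel. integrable lborel (\<lambda>s. case (x, s) of (x, s) \<Rightarrow> H x s)"
      using lborel_pair.AE_integrable_fst'[OF h_int] ne0
    proof eventually_elim
      case (elim x)
      then have "integrable lborel (\<lambda>s. \<bar>x\<bar> * h (x, 0 + x * s))"
        by (intro integrable_mult_right lborel_integrable_real_affine[where f = "\<lambda>y. h (x, y)"]) auto
      then show ?case
        by (simp only: subst[OF elim(2)] prod.case)
    qed
  qed
  have "(\<integral>q. h q \<partial>lborel) = (\<integral>x. \<integral>y. h (x, y) \<partial>lborel \<partial>lborel)"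
    using lborel_pair.integral_fst'[OF h_int] by (simp add: lborel_prod)
  also have "\<dots> = (\<integral>x. \<integral>s. H x s \<partial>lborel \<partial>lborel)"
  proof (rule integral_cong_AE)
    show "AE x in lborel. (\<integral>y. h (x, y) \<partial>lborel) = (\<integral>s. H x s \<partial>lborel)"
      using ne0
    proof eventually_elim
      case (elim x)
      then have "(\<integral>y. h (x, y) \<partial>lborel) = \<bar>x\<bar> *\<^sub>R (\<integral>s. h (x, 0 + x * s) \<partial>lborel)"
        by (rule lborel_integral_real_affine)
      also have "\<dots> = (\<integral>s. \<bar>x\<bar> * h (x, 0 + x * s) \<partial>lborel)"
        by simp
      finally show ?case
        by (simp only: subst[OF elim])
    qed
    show "(\<lambda>x. \<integral>y. h (x, y) \<partial>lborel) \<in> borel_measurable lborel"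
      using lborel_pair.integrable_fst'[OF h_int] by auto
    show "(\<lambda>x. \<integral>s. H x s \<partial>lborel) \<in> borel_measurable lborel"
      using lborel_pair.integrable_fst'[OF H_int] by auto
  qed
  \<comment> \<open>With s fixed and x running, the integrand becomes a derivative along a line
    through z.\<close>
  also have "\<dots> = (\<integral>s. \<integral>x. H x s \<partial>lborel \<partial>lborel)"
    by (rule lborel_pair.Fubini_integral[OF H_int, symmetric])
  also have "\<dots> = (\<integral>s. 2 * f z * (1 / (1 + s\<^sup>2)) \<partial>lborel)"
  proof (rule Bochner_Integration.integral_cong[OF refl])
    fix s
    show "(\<integral>x. H x s \<partial>lborel) = 2 * f z * (1 / (1 + s\<^sup>2))"
      using has_bochner_integral_sgn_line_derivative[of z s]
      by (simp add: H_def has_bochner_integral_iff)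
  qed
  also have "\<dots> = 2 * pi * f z"
    using has_bochner_integral_inverse_1_plus_square
    by (simp only: integral_mult_right_zero has_bochner_integral_iff) simp
  finally show ?thesis
    by (simp only: h_def)
qed

end

section \<open>Reflections of the plane, domination by the kernel, and Fubini's theorem\<close>

section \<open>Exchanging line and area integrals\<close>

lemma lborel_distr_reflect:
  fixes z :: "'a::euclidean_space"
  shows "distr lborel borel (\<lambda>q. z - q) = lborel"
  by (subst lborel_affine[of "-1" z]) (simp_all add: density_1)

lemma integrable_lborel_reflect:
  fixes z :: "'a::euclidean_space" and F :: "'a \<Rightarrow> 'b::{banach, second_countable_topology}"
  assumes "F \<in> borel_measurable borel"
  shows "integrable lborel (\<lambda>q. F (z - q)) \<longleftrightarrow> integrable lborel F"
  by (subst (2) lborel_distr_reflect[of z, symmetric], subst integrable_distr_eq) (use assms in auto)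

lemma integral_lborel_reflect:
  fixes z :: "'a::euclidean_space" and F :: "'a \<Rightarrow> 'b::{banach, second_countable_topology}"
  assumes "F \<in> borel_measurable borel"
  shows "(\<integral>q. F (z - q) \<partial>lborel) = (\<integral>q. F q \<partial>lborel)"
  by (subst (2) lborel_distr_reflect[of z, symmetric], subst integral_distr) (use assms in auto)

text \<open>The bound is a product of an integrable function of s and an integrable function of q.
  This licenses Fubini's theorem despite the singularity at q = 0.\<close>

lemma integrable_dominated_by_point_kernel:
  fixes F :: "real \<times> (real \<times> real) \<Rightarrow> real"
  assumes F: "F \<in> borel_measurable (lborel \<Otimes>\<^sub>M lborel)"
    and le: "\<And>s q. \<bar>F (s, q)\<bar> \<le> C * (indicator {0..1} s * (indicator (cball 0 R) q * norm (point_kernel q)))"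
  shows "integrable (lborel \<Otimes>\<^sub>M lborel) F"
proof (rule Bochner_Integration.integrable_bound)
  let ?k = "\<lambda>q::real \<times> real. indicator (cball 0 R) q * norm (point_kernel q)"
  have [measurable]: "?k \<in> borel_measurable lborel"
    using integrable_point_kernel by (rule borel_measurable_integrable)
  have "integrable (lborel \<Otimes>\<^sub>M lborel) (\<lambda>x::real \<times> (real \<times> real). indicator {0..1} (fst x) * ?k (snd x))"
    by (rule lborel_pair.Fubini_integrable) (auto simp: abs_mult intro!: integrable_point_kernel)
  then show "integrable (lborel \<Otimes>\<^sub>M lborel) (\<lambda>x::real \<times> (real \<times> real). C * (indicator {0..1} (fst x) * ?k (snd x)))"
    by (rule integrable_mult_right)
  show "AE x in lborel \<Otimes>\<^sub>M lborel. norm (F x) \<le> norm (C * (indicator {0..1} (fst x) * ?k (snd x)))"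
    using le by (intro AE_I2) (auto intro: order_trans[OF _ abs_ge_self])
qed (rule F)

text \<open>The cross product is the inner product of a with b turned by a right angle, so
  Cauchy-Schwarz applies.\<close>

lemma abs_cross2_le: "\<bar>cross2 a b\<bar> \<le> norm a * norm b"
proof -
  have "cross2 a b = a \<bullet> (snd b, - fst b)"
    by (simp add: cross2_def inner_prod_def)
  moreover have "norm (snd b, - fst b) = norm b"
    by (simp add: norm_prod_def add.commute)
  ultimately show ?thesis
    using Cauchy_Schwarz_ineq2[of a "(snd b, - fst b)"] by simp
qed

lemma cross2_measurable [measurable (raw)]:
  assumes "F \<in> borel_measurable N" "H \<in> borel_measurable N"
  shows "(\<lambda>x. cross2 (F x) (H x)) \<in> borel_measurable N"
  unfolding cross2_def
  by (intro borel_measurable_diff borel_measurable_times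
      measurable_compose[OF assms(1) fst_borel_measurable] measurable_compose[OF assms(2) snd_borel_measurable]
      measurable_compose[OF assms(1) snd_borel_measurable] measurable_compose[OF assms(2) fst_borel_measurable])

context compactly_supported_C1
begin

text \<open>Substituting q = \<open>\<gamma> s\<close> - p for p and applying Lagrange's identity
  splits the left side into two terms. One is evaluated by
  \<open>point_kernel_representation\<close>, the other vanishes. The assumption
  \<open>closed\<close> is the only link between the curve and its velocity
  \<open>d\<close>.\<close>

proposition integral_cross2_eq_line_integral:
  fixes \<gamma> d :: "real \<Rightarrow> real \<times> real" and e :: "real \<times> real"
  assumes [measurable]: "\<gamma> \<in> borel_measurable borel" "d \<in> borel_measurable borel"
    and \<gamma>_le: "\<And>s. norm (\<gamma> s) \<le> L"
    and d_le: "\<And>s. norm (d s) \<le> V * indicator {0..1} s"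
    and closed: "\<And>q. (\<integral>s. G (\<gamma> s - q) \<bullet> d s \<partial>lborel) = 0"
  shows "(\<integral>p. cross2 (G p) e * (\<integral>s. cross2 (point_kernel (\<gamma> s - p)) (d s) \<partial>lborel) \<partial>lborel)
    = 2 * pi * (\<integral>s. f (\<gamma> s) * (e \<bullet> d s) \<partial>lborel)"
proof -
  obtain B where B: "0 \<le> B" "\<And>p. norm (G p) \<le> B"
    by (rule G_bounded) blast
  \<comment> \<open>Dominating function: if |q| exceeds M + L, then \<open>\<gamma> s\<close> - q
    lies beyond radius M, where the gradient is 0.\<close>
  define W where "W s q = indicator {0..1} s * (indicator (cball 0 (M + L)) q * norm (point_kernel q))"
    for s :: real and q :: "real \<times> real"
  define I1 where "I1 s q = (G (\<gamma> s - q) \<bullet> point_kernel q) * (e \<bullet> d s)" for s q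
  define I2 where "I2 s q = (G (\<gamma> s - q) \<bullet> d s) * (e \<bullet> point_kernel q)" for s q
  define I3 where "I3 s q = cross2 (G (\<gamma> s - q)) e * cross2 (point_kernel q) (d s)" for s q
  define J where "J s p = cross2 (G p) e * cross2 (point_kernel (\<gamma> s - p)) (d s)" for s p
  have I3_eq: "I3 s q = I1 s q - I2 s q" for s q
    by (simp add: I1_def I2_def I3_def cross2_Lagrange)
  have J_eq: "J s p = I3 s (\<gamma> s - p)" for s p
    by (simp add: J_def I3_def)
  have dom: "norm (G (\<gamma> s - q)) * norm (point_kernel q) * (norm e * norm (d s)) \<le> (B * norm e * V) * W s q" for s q
  proof (cases "norm q \<le> M + L")
    case True
    have "norm (G (\<gamma> s - q)) * norm (point_kernel q) * (norm e * norm (d s))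
        \<le> B * norm (point_kernel q) * (norm e * (V * indicator {0..1} s))"
      by (intro mult_mono B d_le order_refl mult_nonneg_nonneg order_trans[OF norm_ge_zero d_le] B) auto
    then show ?thesis
      using True by (simp add: W_def mult_ac)
  next
    case False
    then have "M < norm (\<gamma> s - q)"
      using norm_triangle_ineq2[of q "\<gamma> s"] \<gamma>_le[of s] by (simp add: norm_minus_commute)
    then show ?thesis
      using False by (simp add: G_zero W_def)
  qed
  have I1_meas: "case_prod I1 \<in> borel_measurable (lborel \<Otimes>\<^sub>M lborel)"
    unfolding I1_def split_beta by measurable
  have I2_meas: "case_prod I2 \<in> borel_measurable (lborel \<Otimes>\<^sub>M lborel)"
    unfolding I2_def split_beta by measurable
  have CS: "\<bar>a \<bullet> b\<bar> \<le> norm a * norm b" for a b :: "real \<times> real"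
    by (rule Cauchy_Schwarz_ineq2)
  have "\<bar>I1 s q\<bar> \<le> norm (G (\<gamma> s - q)) * norm (point_kernel q) * (norm e * norm (d s))" for s q
    unfolding I1_def abs_mult by (intro mult_mono CS) auto
  then have I1_int: "integrable (lborel \<Otimes>\<^sub>M lborel) (case_prod I1)"
    by (intro integrable_dominated_by_point_kernel[where C = "B * norm e * V" and R = "M + L"] I1_meas)
       (use order_trans[OF _ dom] in \<open>simp add: W_def\<close>)
  have "\<bar>I2 s q\<bar> \<le> norm (G (\<gamma> s - q)) * norm (point_kernel q) * (norm e * norm (d s))" for s q
  proof -
    have "\<bar>I2 s q\<bar> \<le> (norm (G (\<gamma> s - q)) * norm (d s)) * (norm e * norm (point_kernel q))"
      unfolding I2_def abs_mult by (intro mult_mono CS) auto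
    then show ?thesis
      by (simp add: mult_ac)
  qed
  then have I2_int: "integrable (lborel \<Otimes>\<^sub>M lborel) (case_prod I2)"
    by (intro integrable_dominated_by_point_kernel[where C = "B * norm e * V" and R = "M + L"] I2_meas)
       (use order_trans[OF _ dom] in \<open>simp add: W_def\<close>)
  have I3_int: "integrable (lborel \<Otimes>\<^sub>M lborel) (case_prod I3)"
    using Bochner_Integration.integrable_diff[OF I1_int I2_int] by (simp add: I3_eq split_beta')
  have [measurable]: "I3 s \<in> borel_measurable borel" for s
    unfolding I3_def by measurable
  have J_meas: "case_prod J \<in> borel_measurable (lborel \<Otimes>\<^sub>M lborel)"
    unfolding J_def split_beta by measurable
  \<comment> \<open>For each s the reflection p = \<open>\<gamma> s\<close> - q preserves Lebesgue
    measure, so \<open>J\<close> inherits integrability from \<open>I3\<close>.\<close>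
  have J_int: "integrable (lborel \<Otimes>\<^sub>M lborel) (case_prod J)"
  proof (rule lborel_pair.Fubini_integrable[OF J_meas])
    have "(\<integral>p. norm (J s p) \<partial>lborel) = (\<integral>q. norm (I3 s q) \<partial>lborel)" for s
      unfolding J_eq by (rule integral_lborel_reflect) measurable
    then show "integrable lborel (\<lambda>s. \<integral>p. norm (case (s, p) of (s, p) \<Rightarrow> J s p) \<partial>lborel)"
      using lborel_pair.integrable_fst'[OF integrable_norm[OF I3_int]] by simp
    show "AE s in lborel. integrable lborel (\<lambda>p. case (s, p) of (s, p) \<Rightarrow> J s p)"
      using lborel_pair.AE_integrable_fst'[OF I3_int]
      by eventually_elim (simp add: J_eq integrable_lborel_reflect)
  qed
  have "(\<integral>p. cross2 (G p) e * (\<integral>s. cross2 (point_kernel (\<gamma> s - p)) (d s) \<partial>lborel) \<partial>lborel)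
      = (\<integral>p. \<integral>s. J s p \<partial>lborel \<partial>lborel)"
    by (simp add: J_def)
  also have "\<dots> = (\<integral>s. \<integral>p. J s p \<partial>lborel \<partial>lborel)"
    by (rule lborel_pair.Fubini_integral[OF J_int])
  also have "\<dots> = (\<integral>s. \<integral>q. I3 s q \<partial>lborel \<partial>lborel)"
    unfolding J_eq by (subst integral_lborel_reflect) simp_all
  also have "\<dots> = (\<integral>x. case_prod I3 x \<partial>(lborel \<Otimes>\<^sub>M lborel))"
    using lborel_pair.integral_fst'[OF I3_int] by simp
  also have "\<dots> = (\<integral>x. case_prod I1 x \<partial>(lborel \<Otimes>\<^sub>M lborel)) - (\<integral>x. case_prod I2 x \<partial>(lborel \<Otimes>\<^sub>M lborel))"
    by (subst Bochner_Integration.integral_diff[OF I1_int I2_int, symmetric]) (simp add: I3_eq split_beta')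
  \<comment> \<open>The order of integration differs between the terms: \<open>I2\<close> is
    integrated over s first, so that \<open>closed\<close> applies for fixed q, and
    \<open>I1\<close> over q first, so that the representation formula applies for fixed s.\<close>
  also have "(\<integral>x. case_prod I2 x \<partial>(lborel \<Otimes>\<^sub>M lborel)) = (\<integral>q. \<integral>s. I2 s q \<partial>lborel \<partial>lborel)"
    using lborel_pair.integral_snd[OF I2_int] by simp
  also have "\<dots> = 0"
    by (simp add: I2_def closed)
  also have "(\<integral>x. case_prod I1 x \<partial>(lborel \<Otimes>\<^sub>M lborel)) = (\<integral>s. \<integral>q. I1 s q \<partial>lborel \<partial>lborel)"
    using lborel_pair.integral_fst'[OF I1_int] by simp
  also have "\<dots> = (\<integral>s. 2 * pi * (f (\<gamma> s) * (e \<bullet> d s)) \<partial>lborel)"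
    by (simp only: I1_def integral_mult_left_zero point_kernel_representation mult.assoc)
  finally show ?thesis
    by (simp only: integral_mult_right_zero diff_zero)
qed

end

section \<open>Loops with finitely many break points: velocity, closed gradients, winding
  number\<close>

section \<open>Piecewise smooth loops\<close>

text \<open>The velocity is assembled from the derivatives on the pieces, each cut to the interior
  of its piece. The interiors are disjoint, so at most one summand is nonzero at any time;
  compactness of the pieces gives the uniform bound.\<close>

lemma piecewise_smooth_on_derivative:
  fixes g :: "real \<Rightarrow> 'a::euclidean_space"
  assumes "piecewise_smooth_on g a b"
  obtains d S V where "finite S" "continuous_on {a..b} g" "continuous_on ({a..b} - S) d"
    "\<And>t. t \<in> {a..b} - S \<Longrightarrow> (g has_vector_derivative d t) (at t)"
    "d \<in> borel_measurable borel" "\<And>t. norm (d t) \<le> V * indicator {a..b} t"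
proof -
  obtain p g' where p: "p division_of {a..b}"
    and cont: "\<And>K. K \<in> p \<Longrightarrow> continuous_on K (g' K)"
    and deriv: "\<And>K t. K \<in> p \<Longrightarrow> t \<in> K \<Longrightarrow> (g has_vector_derivative g' K t) (at t within K)"
    using assms unfolding piecewise_smooth_on_def by metis
  have fin: "finite p"
    using p by blast
  have K_cbox: "\<exists>l u. K = {l..u}" if "K \<in> p" for K
    using division_ofD(4)[OF p that] by auto
  have K_sub: "K \<subseteq> {a..b}" if "K \<in> p" for K
    using p that by blast
  \<comment> \<open>Only end points of pieces remain, hence finitely many. They include a and b when
    a \<le> b, so off \<open>S\<close> the derivative is two-sided.\<close>
  define S where "S = {a..b} - (\<Union>K\<in>p. interior K)"
  define d where "d t = (\<Sum>K\<in>p. indicator (interior K) t *\<^sub>R g' K t)" for t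
  have d_eq: "d t = g' K t" if "K \<in> p" "t \<in> interior K" for K t
  proof -
    have "indicator (interior K') t *\<^sub>R g' K' t = 0" if "K' \<in> p - {K}" for K'
      using division_ofD(5)[OF p, of K K'] that \<open>K \<in> p\<close> \<open>t \<in> interior K\<close> by (auto simp: indicator_def)
    then have "(\<Sum>K'\<in>p - {K}. indicator (interior K') t *\<^sub>R g' K' t) = 0"
      by (rule sum.neutral[OF ballI])
    then show ?thesis
      unfolding d_def sum.remove[OF fin that(1)] using that(2) by simp
  qed
  have "finite S"
  proof (rule finite_subset)
    show "S \<subseteq> (\<Union>K\<in>p. K - interior K)"
      using division_ofD(6)[OF p] by (auto simp: S_def)
    show "finite (\<Union>K\<in>p. K - interior K)"
    proof (rule finite_UN_I[OF fin])
      fix K assume "K \<in> p"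
      then obtain l u where "K = {l..u}"
        using K_cbox by blast
      then have "K - interior K \<subseteq> {l, u}"
        by auto
      then show "finite (K - interior K)"
        by (rule finite_subset) simp
    qed
  qed
  moreover have "continuous_on {a..b} g"
  proof -
    have "continuous_on (\<Union>p) g"
      using fin deriv K_cbox has_vector_derivative_continuous
      by (intro continuous_on_closed_Union[of p "\<lambda>K. K", simplified])
         (auto simp: continuous_on_eq_continuous_within intro: has_vector_derivative_continuous)
    then show ?thesis
      using division_ofD(6)[OF p] by simp
  qed
  moreover have "continuous_on ({a..b} - S) d"
  proof -
    have "continuous_on (\<Union>K\<in>p. interior K) d"
    proof (rule continuous_on_open_UN)
      fix K assume K: "K \<in> p"
      have "continuous_on (interior K) (g' K)"
        using cont[OF K] interior_subset continuous_on_subset by blast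
      then show "continuous_on (interior K) d"
        by (rule continuous_on_eq) (simp add: d_eq[OF K])
    qed auto
    moreover have "{a..b} - S \<subseteq> (\<Union>K\<in>p. interior K)"
      by (auto simp: S_def)
    ultimately show ?thesis
      by (rule continuous_on_subset)
  qed
  moreover have "(g has_vector_derivative d t) (at t)" if t: "t \<in> {a..b} - S" for t
  proof -
    obtain K where K: "K \<in> p" "t \<in> interior K"
      using t by (auto simp: S_def)
    then show ?thesis
      using deriv[of K t] d_eq[of K t] at_within_interior[of t K] interior_subset by fastforce
  qed
  moreover have "d \<in> borel_measurable borel"
    unfolding d_def
    by (intro borel_measurable_sum borel_measurable_continuous_on_indicator
        continuous_on_subset[OF cont interior_subset]) auto
  moreover have "\<exists>V. \<forall>t. norm (d t) \<le> V * indicator {a..b} t"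
  proof -
    have "\<exists>B. \<forall>t\<in>K. norm (g' K t) \<le> B" if K: "K \<in> p" for K
    proof -
      have "compact K"
        using K_cbox[OF K] by auto
      then have "bounded (g' K ` K)"
        using cont[OF K] compact_continuous_image compact_imp_bounded by blast
      then show ?thesis
        by (auto simp: bounded_iff)
    qed
    then obtain B where B: "\<And>K t. K \<in> p \<Longrightarrow> t \<in> K \<Longrightarrow> norm (g' K t) \<le> B K"
      by metis
    have "norm (d t) \<le> (\<Sum>K\<in>p. \<bar>B K\<bar>) * indicator {a..b} t" for t
    proof (cases "t \<in> {a..b}")
      case True
      have "norm (indicator (interior K) t *\<^sub>R g' K t) \<le> \<bar>B K\<bar>" if "K \<in> p" for K
        using B[OF that, of t] interior_subset[of K] by (auto simp: indicator_def)
      then show ?thesis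
        using True unfolding d_def by (auto intro!: sum_norm_le)
    next
      case False
      then have "t \<notin> interior K" if "K \<in> p" for K
        using K_sub[OF that] interior_subset by blast
      then show ?thesis
        using False by (simp add: d_def)
    qed
    then show ?thesis
      by blast
  qed
  ultimately show ?thesis
    using that by blast
qed

text \<open>The bound \<open>d_le\<close> forces the velocity to be 0 off the unit interval, so line
  integrals can be written as Lebesgue integrals over the whole real line.\<close>

locale closed_C1_curve =
  fixes \<gamma> d :: "real \<Rightarrow> real \<times> real" and S :: "real set" and V :: real
  assumes finite_S: "finite S"
    and \<gamma>_cont: "continuous_on {0..1} \<gamma>"
    and d_cont: "continuous_on ({0..1} - S) d"
    and \<gamma>_deriv: "\<And>s. s \<in> {0..1} - S \<Longrightarrow> (\<gamma> has_vector_derivative d s) (at s)"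
    and d_measurable [measurable]: "d \<in> borel_measurable borel"
    and d_le: "\<And>s. norm (d s) \<le> V * indicator {0..1} s"
    and \<gamma>_closed: "\<gamma> 0 = \<gamma> 1"
begin

lemma V_nonneg: "0 \<le> V"
  using order_trans[OF norm_ge_zero d_le[of 0]] by simp

lemma d_zero: "s \<notin> {0..1} \<Longrightarrow> d s = 0"
  using d_le[of s] by simp

lemma \<gamma>_bounded:
  obtains L where "0 \<le> L" "\<And>s. s \<in> {0..1} \<Longrightarrow> norm (\<gamma> s) \<le> L"
proof -
  have "bounded (\<gamma> ` {0..1})"
    by (intro compact_imp_bounded compact_continuous_image \<gamma>_cont) auto
  then obtain L where "\<And>s. s \<in> {0..1} \<Longrightarrow> norm (\<gamma> s) \<le> L"
    unfolding bounded_iff by blast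
  then show ?thesis
    using that[of "max L 0"] by (simp add: le_max_iff_disj)
qed

text \<open>Nothing is known about \<open>\<gamma>\<close> off the unit interval. Cutting it there
  by the indicator gives measurability and leaves the line integrals unchanged, because
  \<open>d\<close> vanishes there.\<close>

lemma \<gamma>_indicator_measurable [measurable]: "(\<lambda>s. indicator {0..1} s *\<^sub>R \<gamma> s) \<in> borel_measurable borel"
  by (intro borel_measurable_continuous_on_indicator \<gamma>_cont) auto

text \<open>A differentiable image of a subset of the line is negligible in the plane, and the break
  points add finitely many points. Thus the winding number matters only off the curve.\<close>

lemma path_image_null: "\<gamma> ` {0..1} \<in> null_sets lborel"
proof -
  have "negligible (\<gamma> ` ({0..1} - S))"
  proof (rule negligible_differentiable_image_lowdim)
    show "\<gamma> differentiable_on ({0..1} - S)"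
      using \<gamma>_deriv has_vector_derivative_at_within differentiableI_vector
      unfolding differentiable_on_def by blast
  qed simp
  moreover have "negligible (\<gamma> ` ({0..1} \<inter> S))"
    using finite_S by (intro negligible_finite) auto
  ultimately have "negligible (\<gamma> ` ({0..1} - S) \<union> \<gamma> ` ({0..1} \<inter> S))"
    by (rule negligible_Un)
  moreover have "\<gamma> ` ({0..1} - S) \<union> \<gamma> ` ({0..1} \<inter> S) = \<gamma> ` {0..1}"
    by blast
  ultimately have "\<gamma> ` {0..1} \<in> null_sets lebesgue"
    by (simp add: negligible_iff_null_sets)
  moreover have "\<gamma> ` {0..1} \<in> sets lborel"
    using compact_continuous_image[OF \<gamma>_cont] by (auto intro: borel_compact)
  ultimately show ?thesis
    by (simp add: null_sets_completion_iff)
qed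

text \<open>The integrand is the derivative of f(\<open>\<gamma> s\<close> - q) off the break
  points, and the end points of the loop agree. This supplies the assumption \<open>closed\<close>
  of \<open>integral_cross2_eq_line_integral\<close>.\<close>

lemma integral_closed_gradient:
  assumes "compactly_supported_C1 f G M"
  shows "(\<integral>s. G (indicator {0..1} s *\<^sub>R \<gamma> s - q) \<bullet> d s \<partial>lborel) = 0"
proof -
  interpret compactly_supported_C1 f G M
    by (rule assms)
  obtain B where B: "0 \<le> B" "\<And>p. norm (G p) \<le> B"
    by (rule G_bounded) blast
  let ?I = "\<lambda>s. G (indicator {0..1} s *\<^sub>R \<gamma> s - q) \<bullet> d s"
  have "integrable lborel ?I"
  proof (rule Bochner_Integration.integrable_bound)
    show "integrable lborel (\<lambda>s::real. (B * V) * indicator {0..1} s)"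
      by (intro integrable_mult_right) simp
    show "AE s in lborel. norm (?I s) \<le> norm ((B * V) * indicator {0..1} s :: real)"
    proof (rule AE_I2)
      fix s
      have "norm (?I s) \<le> norm (G (indicator {0..1} s *\<^sub>R \<gamma> s - q)) * norm (d s)"
        using Cauchy_Schwarz_ineq2 by simp
      also have "\<dots> \<le> B * (V * indicator {0..1} s)"
        by (intro mult_mono B d_le) auto
      also have "\<dots> \<le> norm ((B * V) * indicator {0..1} s :: real)"
        by (simp add: mult.assoc)
      finally show "norm (?I s) \<le> norm ((B * V) * indicator {0..1} s :: real)" .
    qed
  qed measurable
  then have "(?I has_integral integral\<^sup>L lborel ?I) UNIV"
    by (rule has_integral_integral_lborel)
  moreover have "((\<lambda>s. G (\<gamma> s - q) \<bullet> d s) has_integral (f (\<gamma> 1 - q) - f (\<gamma> 0 - q))) {0..1}"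
  proof (rule fundamental_theorem_of_calculus_interior_strong[OF finite_S])
    fix s assume s: "s \<in> {0<..<1} - S"
    have "((\<lambda>s. \<gamma> s - q) has_derivative (\<lambda>v. v *\<^sub>R d s)) (at s)"
      using \<gamma>_deriv[of s] s unfolding has_vector_derivative_def
      by (auto intro!: derivative_eq_intros)
    from has_derivative_compose[OF this f_deriv]
    show "((\<lambda>s. f (\<gamma> s - q)) has_vector_derivative G (\<gamma> s - q) \<bullet> d s) (at s)"
      by (simp add: has_vector_derivative_def)
  next
    show "continuous_on {0..1} (\<lambda>s. f (\<gamma> s - q))"
      by (intro continuous_on_compose2[OF f_cont] continuous_intros \<gamma>_cont) auto
  qed simp
  then have "((\<lambda>s. if s \<in> {0..1} then G (\<gamma> s - q) \<bullet> d s else 0) has_integral 0) UNIV"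
    by (simp only: has_integral_restrict_UNIV \<gamma>_closed diff_self)
  moreover have "(\<lambda>s. if s \<in> {0..1} then G (\<gamma> s - q) \<bullet> d s else 0) = ?I"
    using d_zero by fastforce
  ultimately have "(?I has_integral 0) UNIV"
    by simp
  with \<open>(?I has_integral integral\<^sup>L lborel ?I) UNIV\<close> show ?thesis
    by (rule has_integral_unique)
qed

lemma complex_path:
  shows valid_complex_path: "valid_path (\<lambda>s. Complex (fst (\<gamma> s)) (snd (\<gamma> s)))"
    and complex_path_deriv: "\<And>s. s \<in> {0..1} - S \<Longrightarrow>
      ((\<lambda>s. Complex (fst (\<gamma> s)) (snd (\<gamma> s))) has_vector_derivative Complex (fst (d s)) (snd (d s))) (at s)"
proof -
  have lin: "bounded_linear (\<lambda>p::real \<times> real. Complex (fst p) (snd p))"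
    unfolding Complex_eq
    by (intro bounded_linear_add bounded_linear_const_mult bounded_linear_compose[OF bounded_linear_of_real]
        bounded_linear_fst bounded_linear_snd)
  show *: "((\<lambda>s. Complex (fst (\<gamma> s)) (snd (\<gamma> s))) has_vector_derivative Complex (fst (d s)) (snd (d s))) (at s)"
    if "s \<in> {0..1} - S" for s
    using bounded_linear.has_vector_derivative[OF lin \<gamma>_deriv[OF that]] .
  have "continuous_on {0..1} (\<lambda>s. Complex (fst (\<gamma> s)) (snd (\<gamma> s)))"
    by (rule bounded_linear.continuous_on[OF lin \<gamma>_cont])
  moreover have "continuous_on ({0..1} - S) (\<lambda>s. Complex (fst (d s)) (snd (d s)))"
    by (rule bounded_linear.continuous_on[OF lin d_cont])
  ultimately show "valid_path (\<lambda>s. Complex (fst (\<gamma> s)) (snd (\<gamma> s)))"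
    unfolding valid_path_def piecewise_C1_differentiable_on_def C1_differentiable_on_def
    by (intro conjI exI[of _ S] exI[of _ "\<lambda>s. Complex (fst (d s)) (snd (d s))"] ballI * finite_S)
qed

text \<open>With w = \<open>\<gamma>\<close> - p read as a complex number, the integrand is Im (w' /
  w), the angular velocity about p. Its integral is the imaginary part of 2 pi i times the winding
  number.\<close>

lemma integral_point_kernel_eq_winding_number:
  assumes "p \<notin> \<gamma> ` {0..1}"
  shows "(\<integral>s. cross2 (point_kernel (\<gamma> s - p)) (d s) \<partial>lborel)
    = 2 * pi * Re (winding_number (\<lambda>s. Complex (fst (\<gamma> s)) (snd (\<gamma> s))) (Complex (fst p) (snd p)))"
    (is "_ = 2 * pi * Re (winding_number ?g ?z)")
proof -
  let ?I = "\<lambda>s. cross2 (point_kernel (indicator {0..1} s *\<^sub>R \<gamma> s - p)) (d s)"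
  have I_eq: "cross2 (point_kernel (\<gamma> s - p)) (d s) = ?I s" for s
    using d_zero[of s] by (cases "s \<in> {0..1}") (auto simp: cross2_def)
  have closed: "closed (\<gamma> ` {0..1})"
    by (intro compact_imp_closed compact_continuous_image \<gamma>_cont) auto
  \<comment> \<open>The contour integral is a gauge integral. Keeping a distance
    \<open>\<delta>\<close> from the curve bounds the kernel by 1 / \<open>\<delta>\<close>, so the
    Lebesgue integral exists too and the two agree.\<close>
  then obtain \<delta> where \<delta>: "\<delta> > 0" "\<And>q. q \<in> \<gamma> ` {0..1} \<Longrightarrow> \<delta> \<le> dist p q"
    using separate_point_closed[OF closed assms] by blast
  have int: "integrable lborel ?I"
  proof (rule Bochner_Integration.integrable_bound)
    show "integrable lborel (\<lambda>s::real. (V / \<delta>) * indicator {0..1} s)"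
      by (intro integrable_mult_right) simp
    show "AE s in lborel. norm (?I s) \<le> norm ((V / \<delta>) * indicator {0..1} s :: real)"
    proof (rule AE_I2)
      fix s
      show "norm (?I s) \<le> norm ((V / \<delta>) * indicator {0..1} s :: real)"
      proof (cases "s \<in> {0..1}")
        case True
        then have n: "\<delta> \<le> norm (\<gamma> s - p)"
          using \<delta>(2)[of "\<gamma> s"] by (simp add: dist_norm norm_minus_commute)
        have "norm (?I s) \<le> norm (point_kernel (\<gamma> s - p)) * norm (d s)"
          using True abs_cross2_le by simp
        also have "norm (point_kernel (\<gamma> s - p)) = inverse (norm (\<gamma> s - p))"
          by (cases "\<gamma> s = p") (simp_all add: point_kernel_def power2_eq_square)
        also have "\<dots> * norm (d s) \<le> inverse \<delta> * V"
          using n \<delta>(1) d_le[of s] True by (intro mult_mono le_imp_inverse_le) auto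
        finally show ?thesis
          using True \<delta>(1) V_nonneg by (simp add: field_simps)
      next
        case False
        then show ?thesis
          using d_zero[of s] by (simp add: cross2_def)
      qed
    qed
  qed measurable
  have "?z \<notin> path_image ?g"
    using assms by (auto simp: path_image_def complex_eq_iff prod_eq_iff)
  then have "((\<lambda>w. 1 / (w - ?z)) has_contour_integral (2 * pi * \<i> * winding_number ?g ?z)) ?g"
    by (intro has_contour_integral_winding_number valid_complex_path)
  then have Im_int: "((\<lambda>s. Im (1 / (?g s - ?z) * vector_derivative ?g (at s within {0..1})))
      has_integral Im (2 * pi * \<i> * winding_number ?g ?z)) {0..1}"
    unfolding has_contour_integral_def
    by (drule_tac has_integral_linear[OF _ bounded_linear_Im]) (simp add: o_def)
  have "?I s = Im (1 / (?g s - ?z) * vector_derivative ?g (at s within {0..1}))"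
    if "s \<in> {0..1} - S" for s
  proof -
    have "vector_derivative ?g (at s within {0..1}) = Complex (fst (d s)) (snd (d s))"
      using that complex_path_deriv by (intro vector_derivative_at_within_ivl) auto
    then show ?thesis
      using that by (simp add: cross2_def point_kernel_def norm_prod_def Im_divide Re_divide algebra_simps
          diff_divide_distrib divide_inverse)
  qed
  then have "(?I has_integral Im (2 * pi * \<i> * winding_number ?g ?z)) {0..1}"
    by (rule has_integral_spike_finite[OF finite_S _ Im_int])
  then have "((\<lambda>s. if s \<in> {0..1} then ?I s else 0) has_integral 2 * pi * Re (winding_number ?g ?z)) UNIV"
    unfolding has_integral_restrict_UNIV by simp
  moreover have "(\<lambda>s. if s \<in> {0..1} then ?I s else 0) = ?I"
    using d_zero by (fastforce simp: cross2_def)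
  ultimately have "(?I has_integral 2 * pi * Re (winding_number ?g ?z)) UNIV"
    by simp
  then show ?thesis
    unfolding I_eq using has_integral_unique has_integral_integral_lborel[OF int] by blast
qed

text \<open>Off the null set covered by the curve, the kernel integral along the loop is 2 pi times
  the indicator of D; the factor 2 pi then cancels against that of the representation
  formula.\<close>

proposition Green_compact_support:
  assumes "compactly_supported_C1 f G M"
    and D: "D \<in> sets borel"
    and winding: "\<And>p. p \<notin> \<gamma> ` {0..1} \<Longrightarrow>
      winding_number (\<lambda>s. Complex (fst (\<gamma> s)) (snd (\<gamma> s))) (Complex (fst p) (snd p)) = indicator D p"
  shows "(\<integral>p. cross2 (G p) e * indicator D p \<partial>lborel)
    = (\<integral>s. f (indicator {0..1} s *\<^sub>R \<gamma> s) * (e \<bullet> d s) \<partial>lborel)"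
proof -
  interpret compactly_supported_C1 f G M
    by (rule assms)
  obtain L where L: "0 \<le> L" "\<And>s. s \<in> {0..1} \<Longrightarrow> norm (\<gamma> s) \<le> L"
    using \<gamma>_bounded by blast
  let ?g = "\<lambda>s. indicator {0..1} s *\<^sub>R \<gamma> s"
  let ?N = "\<lambda>p. \<integral>s. cross2 (point_kernel (?g s - p)) (d s) \<partial>lborel"
  have N: "?N p = (\<integral>s. cross2 (point_kernel (\<gamma> s - p)) (d s) \<partial>lborel)" for p
    using d_zero by (intro Bochner_Integration.integral_cong) (auto simp: cross2_def indicator_def)
  have [measurable]: "?N \<in> borel_measurable borel"
  proof -
    have "(\<lambda>(p, s). cross2 (point_kernel (?g s - p)) (d s)) \<in> borel_measurable (borel \<Otimes>\<^sub>M lborel)"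
      unfolding split_beta by measurable
    from lborel.borel_measurable_lebesgue_integral[OF this] show ?thesis
      by simp
  qed
  have "(\<integral>p. 2 * pi * (cross2 (G p) e * indicator D p) \<partial>lborel) = (\<integral>p. cross2 (G p) e * ?N p \<partial>lborel)"
  proof (rule integral_cong_AE)
    show "AE p in lborel. 2 * pi * (cross2 (G p) e * indicator D p) = cross2 (G p) e * ?N p"
      using AE_not_in[OF path_image_null]
    proof eventually_elim
      case (elim p)
      then have "?N p = 2 * pi * indicator D p"
        unfolding N using integral_point_kernel_eq_winding_number[OF elim] winding[OF elim]
        by (simp add: indicator_def)
      then show ?case
        by simp
    qed
  qed (use D in measurable)
  also have "\<dots> = 2 * pi * (\<integral>s. f (?g s) * (e \<bullet> d s) \<partial>lborel)"
  proof (rule integral_cross2_eq_line_integral)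
    show "norm (?g s) \<le> L" for s
      using L by (simp add: indicator_def)
    show "(\<integral>s. G (?g s - q) \<bullet> d s \<partial>lborel) = 0" for q
      by (rule integral_closed_gradient[OF assms(1)])
  qed (rule \<gamma>_indicator_measurable d_measurable d_le)+
  finally show ?thesis
    by (simp only: integral_mult_right_zero) simp
qed

end

section \<open>Winding numbers of the boundary loop and cutoff functions\<close>

section \<open>Green's theorem\<close>

text \<open>The Jordan interior of the loop is connected, misses the frontier of D, and meets D
  because interior points of D have winding number 1. Hence it lies within D, and a point outside D
  is in the Jordan exterior, where the winding number is 0.\<close>

lemma loop_winding_number_eq_indicator:
  assumes "0 < T" "continuous_on {0..T} \<Gamma>"
    and "compact_domain D" "traverses_frontier_once_positively T \<Gamma> D"
    and p: "p \<notin> frontier D"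
  shows "loop_winding_number T \<Gamma> p = indicator D p"
proof (cases "p \<in> D")
  case True
  then have "p \<in> interior D"
    using p closure_subset by (auto simp: frontier_def)
  then show ?thesis
    using True assms(4) by (simp add: traverses_frontier_once_positively_def)
next
  case False
  define c where "c s = Complex (fst (\<Gamma> (T * s))) (snd (\<Gamma> (T * s)))" for s
  have \<Gamma>_inj: "inj_on \<Gamma> {0..<T}" and \<Gamma>_closed: "\<Gamma> 0 = \<Gamma> T" and \<Gamma>_image: "\<Gamma> ` {0..T} = frontier D"
    and one: "\<And>q. q \<in> interior D \<Longrightarrow> winding_number c (Complex (fst q) (snd q)) = 1"
    using assms(4) by (auto simp: traverses_frontier_once_positively_def loop_winding_number_def c_def[abs_def])
  have image: "z \<in> path_image c \<longleftrightarrow> (Re z, Im z) \<in> frontier D" for z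
  proof -
    have "(*) T ` {0..1} = {0..T}"
      using assms(1) by (simp add: image_mult_atLeastAtMost)
    then have "frontier D = (\<lambda>s. \<Gamma> (T * s)) ` {0..1}"
      using \<Gamma>_image by (metis image_image)
    then show ?thesis
      by (auto simp: path_image_def c_def complex_eq_iff prod_eq_iff)
  qed
  have "continuous_on {0..1} c"
    unfolding c_def Complex_eq
    by (intro continuous_intros continuous_on_compose2[OF assms(2)]) (use assms(1) in \<open>auto simp: mult_le_cancel_left1\<close>)
  then have "path c"
    by (simp add: path_def)
  moreover have "loop_free c"
    unfolding loop_free_def
  proof (intro ballI impI)
    fix s t :: real
    assume st: "s \<in> {0..1}" "t \<in> {0..1}" "c s = c t"
    \<comment> \<open>Parameter 1 is moved to 0, so that injectivity on the half-open interval
      \<open>{0..<T}\<close> applies; the two parameters give the same point of the loop.\<close>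
    define m where "m s = (if s = 1 then 0 else s)" for s :: real
    have m: "T * m s \<in> {0..<T}" if "s \<in> {0..1}" for s
      using that assms(1) by (auto simp: m_def)
    have "\<Gamma> (T * m s) = \<Gamma> (T * s)" for s
      using \<Gamma>_closed by (simp add: m_def)
    then have "\<Gamma> (T * m s) = \<Gamma> (T * m t)"
      using st(3) by (simp add: c_def prod_eq_iff)
    then have "T * m s = T * m t"
      by (rule inj_onD[OF \<Gamma>_inj _ m[OF st(1)] m[OF st(2)]])
    then have "m s = m t"
      using assms(1) by simp
    then show "s = t \<or> s = 0 \<and> t = 1 \<or> s = 1 \<and> t = 0"
      by (auto simp: m_def split: if_splits)
  qed
  ultimately have simple: "simple_path c"
    by (simp add: simple_path_def)
  have loop: "pathfinish c = pathstart c"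
    using \<Gamma>_closed by (simp add: pathfinish_def pathstart_def c_def)
  define \<Omega> where "\<Omega> = (\<lambda>z. (Re z, Im z)) ` inside (path_image c)"
  have "connected \<Omega>"
    unfolding \<Omega>_def using Jordan_inside_outside[OF simple loop]
    by (intro connected_continuous_image continuous_intros) auto
  moreover have "\<Omega> \<inter> frontier D = {}"
  proof -
    have "z \<notin> path_image c" if "z \<in> inside (path_image c)" for z
      using that inside_no_overlap[of "path_image c"] by blast
    then show ?thesis
      by (auto simp: \<Omega>_def image)
  qed
  moreover have "\<Omega> \<inter> D \<noteq> {}"
  proof -
    obtain q where q: "q \<in> interior D"
      using assms(3) by (metis compact_domain_def closure_empty ex_in_conv)
    then have "Complex (fst q) (snd q) \<notin> outside (path_image c)"
      using one[OF q] winding_number_zero_in_outside[OF \<open>path c\<close> loop] by auto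
    moreover have "Complex (fst q) (snd q) \<notin> path_image c"
      using q by (simp add: image frontier_def)
    ultimately have "Complex (fst q) (snd q) \<in> inside (path_image c)"
      using inside_Un_outside by blast
    then have "q \<in> \<Omega>"
      unfolding \<Omega>_def by (rule rev_image_eqI) simp
    then show ?thesis
      using q interior_subset by blast
  qed
  ultimately have "p \<notin> \<Omega>"
    using connected_Int_frontier[of \<Omega> D] False by blast
  have "Complex (fst p) (snd p) \<notin> inside (path_image c)"
  proof
    assume "Complex (fst p) (snd p) \<in> inside (path_image c)"
    then have "p \<in> \<Omega>"
      unfolding \<Omega>_def by (rule rev_image_eqI) simp
    with \<open>p \<notin> \<Omega>\<close> show False ..
  qed
  moreover have "Complex (fst p) (snd p) \<notin> path_image c"
    using p by (simp add: image)
  ultimately have "Complex (fst p) (snd p) \<in> outside (path_image c)"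
    using inside_Un_outside by blast
  then show ?thesis
    using False winding_number_zero_in_outside[OF \<open>path c\<close> loop]
    by (simp add: loop_winding_number_def c_def[abs_def])
qed

text \<open>The squared positive part is the building block of the cutoff: it is C^1, since at the
  kink its difference quotient is \<open>max 0 t\<close>, which tends to 0.\<close>

lemma has_derivative_max_0_power2:
  fixes h :: "'a::real_normed_vector \<Rightarrow> real"
  assumes "(h has_derivative h') (at p)"
  shows "((\<lambda>p. (max 0 (h p))\<^sup>2) has_derivative (\<lambda>v. 2 * max 0 (h p) * h' v)) (at p)"
proof -
  have "((\<lambda>t. (max 0 t)\<^sup>2) has_real_derivative 2 * max 0 t) (at t)" for t :: real
  proof -
    consider "t < 0" | "t = 0" | "0 < t"
      by linarith
    then show ?thesis
    proof cases
      case 1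
      have "((\<lambda>t. 0) has_real_derivative 0) (at t)"
        by simp
      then have "((\<lambda>t. (max 0 t)\<^sup>2) has_real_derivative 0) (at t)"
        by (rule has_field_derivative_transform_within_open[where S = "{..<0}"]) (use 1 in auto)
      then show ?thesis
        using 1 by simp
    next
      case 2
      have "((\<lambda>t. max 0 t) \<longlongrightarrow> max 0 (0::real)) (at 0)"
        by (intro tendsto_intros)
      moreover have "eventually (\<lambda>t::real. max 0 t = (max 0 (0 + t))\<^sup>2 / t) (at 0)"
        by (auto simp: eventually_at_filter max_def power2_eq_square)
      ultimately have "((\<lambda>t::real. (max 0 (0 + t))\<^sup>2 / t) \<longlongrightarrow> max 0 0) (at 0)"
        by (rule Lim_transform_eventually)
      then show ?thesis
        using 2 by (simp add: DERIV_def)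
    next
      case 3
      have "((\<lambda>t. t\<^sup>2) has_real_derivative 2 * t) (at t)"
        by (auto intro!: derivative_eq_intros)
      then have "((\<lambda>t. (max 0 t)\<^sup>2) has_real_derivative 2 * t) (at t)"
        by (rule has_field_derivative_transform_within_open[where S = "{0<..}"]) (use 3 in auto)
      then show ?thesis
        using 3 by simp
    qed
  qed
  from has_derivative_compose[OF assms this[unfolded has_field_derivative_def]]
  show ?thesis .
qed

text \<open>The factor \<open>P (h p)\<close> is 1 for |p| \<le> R, where the inner squared positive
  part is 0, and it vanishes once |p|^2 \<ge> R^2 + 1, in particular for |p| \<ge> |R| + 1.\<close>

lemma compactly_supported_C1_cutoff:
  fixes f :: "real \<times> real \<Rightarrow> real"
  assumes f_deriv: "\<And>p. (f has_derivative (\<lambda>v. G p \<bullet> v)) (at p)"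
    and G_cont: "continuous_on UNIV G"
  obtains f' G' M where "compactly_supported_C1 f' G' M"
    "\<And>p. norm p \<le> R \<Longrightarrow> f' p = f p" "\<And>p. norm p \<le> R \<Longrightarrow> G' p = G p"
proof -
  define P :: "real \<Rightarrow> real" where "P t = (max 0 t)\<^sup>2" for t
  define h where "h p = 1 - P (p \<bullet> p - R\<^sup>2)" for p :: "real \<times> real"
  define f' where "f' p = f p * P (h p)" for p
  \<comment> \<open>Product and chain rule; the 4 combines the 2 from the inner square with the 2 in
    the gradient 2 p of |p|^2.\<close>
  define G' where "G' p = P (h p) *\<^sub>R G p - (f p * (2 * max 0 (h p)) * (4 * max 0 (p \<bullet> p - R\<^sup>2))) *\<^sub>R p" for p
  have f_cont: "continuous_on UNIV f"
    by (intro continuous_at_imp_continuous_on ballI has_derivative_continuous[OF f_deriv])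
  have h_cont: "continuous_on UNIV h"
    unfolding h_def P_def by (intro continuous_intros)
  have "compactly_supported_C1 f' G' (\<bar>R\<bar> + 1)"
  proof
    fix p :: "real \<times> real"
    have "((\<lambda>p. p \<bullet> p - R\<^sup>2) has_derivative (\<lambda>v. 2 * (p \<bullet> v))) (at p)"
      by (auto intro!: derivative_eq_intros simp: inner_commute)
    from has_derivative_diff[OF has_derivative_const[of 1] has_derivative_max_0_power2[OF this]]
    have "(h has_derivative (\<lambda>v. - (2 * max 0 (p \<bullet> p - R\<^sup>2) * (2 * (p \<bullet> v))))) (at p)"
      by (simp add: h_def[abs_def] P_def)
    note d = has_derivative_mult[OF f_deriv has_derivative_max_0_power2[OF this]]
    have "(\<lambda>v. f p * (2 * max 0 (h p) * - (2 * max 0 (p \<bullet> p - R\<^sup>2) * (2 * (p \<bullet> v)))) + G p \<bullet> v * (max 0 (h p))\<^sup>2)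
        = (\<lambda>v. G' p \<bullet> v)"
      by (simp add: G'_def P_def fun_eq_iff inner_diff_left)
    with d show "(f' has_derivative (\<lambda>v. G' p \<bullet> v)) (at p)"
      by (simp only: f'_def[abs_def] P_def)
  next
    show "continuous_on UNIV G'"
      unfolding G'_def P_def by (intro continuous_intros f_cont h_cont G_cont)
  next
    fix p :: "real \<times> real"
    assume "\<bar>R\<bar> + 1 \<le> norm p"
    then have "(\<bar>R\<bar> + 1)\<^sup>2 \<le> (norm p)\<^sup>2"
      by (intro power_mono) auto
    then have "1 \<le> p \<bullet> p - R\<^sup>2"
      by (simp add: power2_norm_eq_inner power2_sum)
    then have "1 \<le> P (p \<bullet> p - R\<^sup>2)"
      by (simp add: P_def)
    then show "f' p = 0"
      by (simp add: f'_def h_def P_def)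
  qed
  moreover have "f' p = f p" "G' p = G p" if "norm p \<le> R" for p :: "real \<times> real"
  proof -
    have "p \<bullet> p \<le> R\<^sup>2"
      using that power_mono[OF that norm_ge_zero, of 2] by (simp add: power2_norm_eq_inner)
    then show "f' p = f p" "G' p = G p"
      by (simp_all add: f'_def G'_def h_def P_def)
  qed
  ultimately show ?thesis
    using that by blast
qed

lemma integrable_on_compact:
  fixes F :: "'a::euclidean_space \<Rightarrow> 'b::euclidean_space"
  assumes "compact D" "continuous_on D F"
  shows "F integrable_on D" "(\<integral>p. indicator D p *\<^sub>R F p \<partial>lborel) = integral D F"
  using set_borel_integral_eq_integral[of D F] borel_integrable_compact[OF assms]
  by (auto simp: set_integrable_def set_lebesgue_integral_def)

section \<open>Green's theorem without compact support\<close>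

context closed_C1_curve
begin

text \<open>A cutoff outside a disc that contains both D and the curve changes neither integral, so
  the compactly supported case applies. The constant vector e selects the direction of the field f
  e.\<close>

theorem Green:
  fixes f :: "real \<times> real \<Rightarrow> real"
  assumes f_deriv: "\<And>p. (f has_derivative (\<lambda>v. G p \<bullet> v)) (at p)"
    and G_cont: "continuous_on UNIV G"
    and D: "compact D"
    and winding: "\<And>p. p \<notin> \<gamma> ` {0..1} \<Longrightarrow>
      winding_number (\<lambda>s. Complex (fst (\<gamma> s)) (snd (\<gamma> s))) (Complex (fst p) (snd p)) = indicator D p"
  shows "((\<lambda>s. f (\<gamma> s) * (e \<bullet> d s)) has_integral integral D (\<lambda>p. cross2 (G p) e)) {0..1}"
proof -
  have "bounded (D \<union> \<gamma> ` {0..1})"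
    using compact_imp_bounded[OF D] compact_imp_bounded[OF compact_continuous_image[OF \<gamma>_cont]] by simp
  then obtain R where R: "\<And>p. p \<in> D \<union> \<gamma> ` {0..1} \<Longrightarrow> norm p \<le> R"
    unfolding bounded_iff by blast
  obtain f' G' M where C1: "compactly_supported_C1 f' G' M"
    and f': "\<And>p. norm p \<le> R \<Longrightarrow> f' p = f p" and G': "\<And>p. norm p \<le> R \<Longrightarrow> G' p = G p"
    using compactly_supported_C1_cutoff[OF f_deriv G_cont] by blast
  interpret compactly_supported_C1 f' G' M
    by (rule C1)
  obtain B where B: "0 \<le> B" "\<And>p. norm (f' p) \<le> B"
    by (rule f_bounded) blast
  let ?I = "\<lambda>s. f' (indicator {0..1} s *\<^sub>R \<gamma> s) * (e \<bullet> d s)"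
  have "integral D (\<lambda>p. cross2 (G p) e) = (\<integral>p. indicator D p *\<^sub>R cross2 (G p) e \<partial>lborel)"
  proof (rule integrable_on_compact(2)[symmetric, OF D])
    have [continuous_intros]: "continuous_on D G"
      by (rule continuous_on_subset[OF assms(2)]) simp
    show "continuous_on D (\<lambda>p. cross2 (G p) e)"
      unfolding cross2_def by (intro continuous_intros)
  qed
  also have "\<dots> = (\<integral>p. cross2 (G' p) e * indicator D p \<partial>lborel)"
    using R G' by (intro Bochner_Integration.integral_cong) (auto simp: indicator_def)
  also have "\<dots> = integral\<^sup>L lborel ?I"
    using D by (intro Green_compact_support[OF C1 _ winding]) (auto intro: borel_compact)
  finally have eq: "integral D (\<lambda>p. cross2 (G p) e) = integral\<^sup>L lborel ?I" .
  have "integrable lborel ?I"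
  proof (rule Bochner_Integration.integrable_bound)
    show "integrable lborel (\<lambda>s::real. (B * norm e * V) * indicator {0..1} s)"
      by (intro integrable_mult_right) simp
    show "AE s in lborel. norm (?I s) \<le> norm ((B * norm e * V) * indicator {0..1} s :: real)"
    proof (rule AE_I2)
      fix s
      have "norm (?I s) \<le> norm (f' (indicator {0..1} s *\<^sub>R \<gamma> s)) * (norm e * norm (d s))"
        unfolding norm_mult real_norm_def abs_mult by (intro mult_left_mono Cauchy_Schwarz_ineq2) simp
      also have "\<dots> \<le> B * (norm e * (V * indicator {0..1} s))"
        by (intro mult_mono B d_le) auto
      also have "\<dots> \<le> norm ((B * norm e * V) * indicator {0..1} s :: real)"
        by (simp add: mult.assoc)
      finally show "norm (?I s) \<le> norm ((B * norm e * V) * indicator {0..1} s :: real)" .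
    qed
  qed measurable
  then have "(?I has_integral integral D (\<lambda>p. cross2 (G p) e)) UNIV"
    unfolding eq by (rule has_integral_integral_lborel)
  moreover have "?I = (\<lambda>s. if s \<in> {0..1} then f (\<gamma> s) * (e \<bullet> d s) else 0)"
  proof
    fix s
    show "?I s = (if s \<in> {0..1} then f (\<gamma> s) * (e \<bullet> d s) else 0)"
      using f'[of "\<gamma> s"] R[of "\<gamma> s"] d_zero[of s] by (cases "s \<in> {0..1}") simp_all
  qed
  ultimately show ?thesis
    by (simp only: has_integral_restrict_UNIV)
qed

end

section \<open>The displacement of the rolling sphere\<close>

lemma vector_2_eq_axis: "(vector [a, b] :: real^2) = a *\<^sub>R axis 1 1 + b *\<^sub>R axis 2 1"
  by (simp add: vec_eq_iff forall_2 axis_def)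

theorem mainTheorem3:
  fixes r \<rho> h w I\<^sub>s J c T :: real
    and D :: "(real \<times> real) set"
    and \<phi>\<^sub>1 \<phi>\<^sub>2 :: "real \<Rightarrow> real"
    and x :: "real \<Rightarrow> real^2"
  assumes "0 < r" "0 < \<rho>" "0 < h" "0 < w" "0 < I\<^sub>s" "0 < J" "0 < T"
    and "c = \<rho> * I\<^sub>s / (2 * w * (I\<^sub>s + J))"
    and "compact_domain D"
    and "piecewise_smooth_on (\<lambda>t. (\<phi>\<^sub>1 t, \<phi>\<^sub>2 t)) 0 T"
    and "traverses_frontier_once_positively T (\<lambda>t. (\<phi>\<^sub>1 t, \<phi>\<^sub>2 t)) D"
    and "rolling_solution r \<rho> h c T \<phi>\<^sub>1 \<phi>\<^sub>2 x"
  shows "x T - x 0 =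
    - (c * r * \<rho> / h) *\<^sub>R
      integral D (\<lambda>(u\<^sub>1, u\<^sub>2). vector [cos (c * (u\<^sub>1 - u\<^sub>2)), sin (c * (u\<^sub>1 - u\<^sub>2))])"
proof -
  define \<Gamma> where "\<Gamma> t = (\<phi>\<^sub>1 t, \<phi>\<^sub>2 t)" for t
  define \<kappa> where "\<kappa> = r * \<rho> / (2 * h)"
  have T: "0 < T" and D: "compact D"
    using assms by (auto simp: compact_domain_def)
  have smooth: "piecewise_smooth_on \<Gamma> 0 T"
    using assms(10) by (simp add: \<Gamma>_def[abs_def])
  obtain d S V where S: "finite S" and \<Gamma>_cont: "continuous_on {0..T} \<Gamma>"
    and d_cont: "continuous_on ({0..T} - S) d"
    and \<Gamma>_deriv: "\<And>t. t \<in> {0..T} - S \<Longrightarrow> (\<Gamma> has_vector_derivative d t) (at t)"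
    and d_meas: "d \<in> borel_measurable borel"
    and d_le: "\<And>t. norm (d t) \<le> V * indicator {0..T} t"
    by (rule piecewise_smooth_on_derivative[OF smooth], rule that, assumption+)
  obtain S' where S': "finite S'" and x_cont: "continuous_on {0..T} x"
    and x_deriv: "\<And>t. t \<in> {0<..<T} - S' \<Longrightarrow> (x has_vector_derivative
        (r * \<rho> / (2 * h) * (deriv \<phi>\<^sub>1 t + deriv \<phi>\<^sub>2 t)) *\<^sub>R
          vector [- sin (c * (\<phi>\<^sub>1 t - \<phi>\<^sub>2 t)), cos (c * (\<phi>\<^sub>1 t - \<phi>\<^sub>2 t))]) (at t)"
    using assms(12) unfolding rolling_solution_def by blast
  \<comment> \<open>The loop is rescaled to the unit interval, where winding numbers are defined;
    the velocity acquires a factor T. The set \<open>S1\<close> collects the rescaled exceptional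
    times of both the loop and the solution.\<close>
  define \<gamma> where "\<gamma> s = \<Gamma> (T * s)" for s
  define d' where "d' s = T *\<^sub>R d (T * s)" for s
  define S1 where "S1 = (\<lambda>t. t / T) ` (S \<union> S')"
  have S1: "T * s \<notin> S" "T * s \<notin> S'" if "s \<notin> S1" for s
    using that T by (force simp: S1_def)+
  have scale_mem: "T * s \<in> {0..T} \<longleftrightarrow> s \<in> {0..1}" for s
    using T by (auto simp: zero_le_mult_iff)
  have scale_deriv: "((*) T has_derivative (\<lambda>v. T * v)) (at s)" for s
    by (auto intro!: derivative_eq_intros)
  interpret closed_C1_curve \<gamma> d' S1 "T * V"
  proof
    show "finite S1"
      using S S' by (simp add: S1_def)
    show "continuous_on {0..1} \<gamma>"
      unfolding \<gamma>_def using scale_mem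
      by (intro continuous_on_compose2[OF \<Gamma>_cont] continuous_intros) blast
    show "continuous_on ({0..1} - S1) d'"
      unfolding d'_def using scale_mem S1
      by (intro continuous_on_compose2[OF d_cont] continuous_intros) blast
    show "(\<gamma> has_vector_derivative d' s) (at s)" if "s \<in> {0..1} - S1" for s
    proof -
      have "(\<Gamma> has_derivative (\<lambda>v. v *\<^sub>R d (T * s))) (at (T * s))"
        using \<Gamma>_deriv[of "T * s"] that scale_mem S1 by (auto simp: has_vector_derivative_def)
      from has_derivative_compose[OF scale_deriv this] show ?thesis
        by (simp add: has_vector_derivative_def \<gamma>_def[abs_def] d'_def mult.commute)
    qed
    show "d' \<in> borel_measurable borel"
      unfolding d'_def using d_meas by measurable
    show "norm (d' s) \<le> T * V * indicator {0..1} s" for s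
      using d_le[of "T * s"] T scale_mem[of s] by (auto simp: d'_def indicator_def mult.assoc)
    show "\<gamma> 0 = \<gamma> 1"
      using assms(11) by (simp add: \<gamma>_def \<Gamma>_def traverses_frontier_once_positively_def)
  qed
  have \<gamma>_image: "\<gamma> ` {0..1} = frontier D"
  proof -
    have "(*) T ` {0..1} = {0..T}"
      using T by (simp add: image_mult_atLeastAtMost)
    then show ?thesis
      using assms(11) unfolding traverses_frontier_once_positively_def \<gamma>_def \<Gamma>_def
      by (metis (no_types, lifting) image_cong image_image)
  qed
  have winding: "winding_number (\<lambda>s. Complex (fst (\<gamma> s)) (snd (\<gamma> s))) (Complex (fst p) (snd p)) = indicator D p"
    if "p \<notin> \<gamma> ` {0..1}" for p
    using loop_winding_number_eq_indicator[OF T \<Gamma>_cont assms(9), of p] assms(11) that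
    unfolding \<gamma>_image loop_winding_number_def \<gamma>_def \<Gamma>_def by simp
  define v :: "real \<times> real \<Rightarrow> real^2" where
    "v p = vector [- sin (c * (fst p - snd p)), cos (c * (fst p - snd p))]" for p
  \<comment> \<open>The inner product of (1, 1) with the velocity is the sum of the two wheel
    speeds, so the rolling constraint presents each component of x as a line integral of a field f e
    with e = (1, 1).\<close>
  have "((\<lambda>s. (\<kappa> * ((1, 1) \<bullet> d' s)) *\<^sub>R v (\<gamma> s)) has_integral (x (T * 1) - x (T * 0))) {0..1}"
  proof (rule fundamental_theorem_of_calculus_interior_strong[OF finite_S])
    show "continuous_on {0..1} (\<lambda>s. x (T * s))"
      using scale_mem by (intro continuous_on_compose2[OF x_cont] continuous_intros) blast
    fix s assume s: "s \<in> {0<..<1} - S1"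
    then have Ts: "T * s \<in> {0<..<T} - S'" "T * s \<in> {0..T} - S"
      using T S1 scale_mem[of s] by auto
    have "(\<Gamma> has_vector_derivative d (T * s)) (at (T * s))"
      using \<Gamma>_deriv Ts by blast
    then have "(\<phi>\<^sub>1 has_vector_derivative fst (d (T * s))) (at (T * s))"
      "(\<phi>\<^sub>2 has_vector_derivative snd (d (T * s))) (at (T * s))"
      using bounded_linear.has_vector_derivative[OF bounded_linear_fst, of \<Gamma>]
        bounded_linear.has_vector_derivative[OF bounded_linear_snd, of \<Gamma>]
      by (simp_all add: \<Gamma>_def)
    then have "deriv \<phi>\<^sub>1 (T * s) = fst (d (T * s))" "deriv \<phi>\<^sub>2 (T * s) = snd (d (T * s))"
      by (auto intro!: DERIV_imp_deriv simp: has_real_derivative_iff_has_vector_derivative)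
    then have "(x has_derivative (\<lambda>u. u *\<^sub>R (\<kappa> * ((1, 1) \<bullet> d (T * s))) *\<^sub>R v (\<gamma> s))) (at (T * s))"
      using x_deriv[OF Ts(1)]
      by (simp add: has_vector_derivative_def \<kappa>_def v_def \<gamma>_def \<Gamma>_def inner_prod_def)
    from has_derivative_compose[OF scale_deriv this]
    show "((\<lambda>s. x (T * s)) has_vector_derivative (\<kappa> * ((1, 1) \<bullet> d' s)) *\<^sub>R v (\<gamma> s)) (at s)"
      by (simp add: has_vector_derivative_def d'_def mult_ac)
  qed simp
  then have x_int: "((\<lambda>s. (\<kappa> * ((1, 1) \<bullet> d' s)) * (v (\<gamma> s) $ i)) has_integral (x T - x 0) $ i) {0..1}" for i
    by (drule_tac has_integral_linear[OF _ bounded_linear_vec_nth[of i]]) (simp add: o_def)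
  let ?C = "\<lambda>p. cos (c * (fst p - snd p))" and ?Z = "\<lambda>p. sin (c * (fst p - snd p))"
  \<comment> \<open>Since f depends only on the difference of the angles, its gradient is c g (-1,
    1), whose cross product with (1, 1) is -2 c g. Multiplied by \<open>\<kappa>\<close>, the factor
    -2 c becomes the constant - c r \<open>\<rho>\<close> / h of the claim.\<close>
  have comp: "(x T - x 0) $ i = \<kappa> * integral D (\<lambda>p. -2 * c * g p)"
    if f: "\<And>p. f p = v p $ i"
      and f_deriv: "\<And>p. (f has_derivative (\<lambda>u. (- c * g p, c * g p) \<bullet> u)) (at p)"
      and g_cont: "continuous_on UNIV g" for i f g
  proof -
    have "((\<lambda>s. f (\<gamma> s) * ((1, 1) \<bullet> d' s)) has_integral
        integral D (\<lambda>p. cross2 (- c * g p, c * g p) (1, 1))) {0..1}"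
      by (rule Green[OF f_deriv _ D winding]) (intro continuous_intros g_cont)
    from has_integral_mult_right[OF this, of \<kappa>]
    have "((\<lambda>s. (\<kappa> * ((1, 1) \<bullet> d' s)) * (v (\<gamma> s) $ i)) has_integral
        \<kappa> * integral D (\<lambda>p. -2 * c * g p)) {0..1}"
      by (simp add: f cross2_def mult_ac)
    with x_int show ?thesis
      by (rule has_integral_unique)
  qed
  have "(x T - x 0) $ 1 = \<kappa> * integral D (\<lambda>p. -2 * c * ?C p)"
    by (rule comp[where f = "\<lambda>p. - ?Z p"])
       (auto simp: v_def inner_prod_def algebra_simps intro!: derivative_eq_intros continuous_intros)
  moreover have "(x T - x 0) $ 2 = \<kappa> * integral D (\<lambda>p. -2 * c * ?Z p)"
    by (rule comp[where f = ?C])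
       (auto simp: v_def inner_prod_def algebra_simps intro!: derivative_eq_intros continuous_intros)
  moreover have "integral D (\<lambda>(u\<^sub>1, u\<^sub>2). vector [cos (c * (u\<^sub>1 - u\<^sub>2)), sin (c * (u\<^sub>1 - u\<^sub>2))] :: real^2)
      = vector [integral D ?C, integral D ?Z]"
  proof -
    have "continuous_on D (\<lambda>p. vector [?C p, ?Z p] :: real^2)"
      unfolding vector_2_eq_axis by (intro continuous_intros)
    note component = integral_component_eq_cart[OF integrable_on_compact(1)[OF D this]]
    show ?thesis
      unfolding split_beta by (simp add: vec_eq_iff forall_2 flip: component)
  qed
  ultimately show ?thesis
    by (simp add: vec_eq_iff forall_2 \<kappa>_def)
qed

end
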